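(* Let $R$ be a semipotent ring. The following are equivalent: (1) $R/J(R)$ is a UQ ring; (2) $R/J(R)$ is a Boolean ring; (3) $R$ is a UJ ring; (4) $R/J(R)$ is a UU ring; (5) $R$ is a UQ ring such that $QN(R)=J(R)$.
   Context: Rings are associative with identity, not necessarily commutative. For a ring $R$: $J(R)$ is the Jacobson radical, $U(R)$ the group of units, $N(R)$ the set of nilpotent elements, and $QN(R)$ the set of quasinilpotent elements, where $a\in R$ is quasinilpotent if $1-ax\in U(R)$ for every $x\in R$ with $ax=xa$. A ring $R$ is UQ if $U(R)=1+QN(R)$, UJ if $U(R)=1+J(R)$, and UU if $U(R)=1+N(R)$. A ring $R$ is semipotent if every one-sided ideal of $R$ not contained in $J(R)$ contains a nonzero idempotent. A ring is Boolean if all of its elements are idempotent. *)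

theory Defs
  imports "HOL-Algebra.QuotRing"
begin

text \<open>
  The locale \<^locale>\<open>ring\<close> is that of associative, not necessarily commutative rings with
  identity (the zero ring included), but \<^locale>\<open>ideal\<close> is two-sided, so one-sided ideals
  are introduced here.
\<close>

locale left_ideal = additive_subgroup I R + ring R for I and R (structure) +
  assumes l_closed: "\<lbrakk>a \<in> I; x \<in> carrier R\<rbrakk> \<Longrightarrow> x \<otimes> a \<in> I"

locale right_ideal = additive_subgroup I R + ring R for I and R (structure) +
  assumes r_closed: "\<lbrakk>a \<in> I; x \<in> carrier R\<rbrakk> \<Longrightarrow> a \<otimes> x \<in> I"

locale maximal_left_ideal = left_ideal +
  assumes not_carrier: "I \<noteq> carrier R"
    and maximal: "\<lbrakk>left_ideal L R; I \<subseteq> L\<rbrakk> \<Longrightarrow> L = I \<or> L = carrier R"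

text \<open>
  The Jacobson radical is the intersection of the maximal left ideals, taken within the carrier:
  the zero ring has no maximal left ideal and is its own radical.
\<close>

definition jacobson_radical :: "('a, 'b) ring_scheme \<Rightarrow> 'a set"
  where "jacobson_radical R = {a \<in> carrier R. \<forall>M. maximal_left_ideal M R \<longrightarrow> a \<in> M}"

definition nilpotents :: "('a, 'b) ring_scheme \<Rightarrow> 'a set"
  where "nilpotents R = {a \<in> carrier R. \<exists>n::nat. n > 0 \<and> a [^]\<^bsub>R\<^esub> n = \<zero>\<^bsub>R\<^esub>}"

definition quasinilpotents :: "('a, 'b) ring_scheme \<Rightarrow> 'a set"
  where "quasinilpotents R = {a \<in> carrier R. \<forall>x \<in> carrier R.
    a \<otimes>\<^bsub>R\<^esub> x = x \<otimes>\<^bsub>R\<^esub> a \<longrightarrow> \<one>\<^bsub>R\<^esub> \<ominus>\<^bsub>R\<^esub> a \<otimes>\<^bsub>R\<^esub> x \<in> Units R}"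

locale UQ_ring = ring +
  assumes Units_eq_quasinilpotents: "Units R = \<one> <+ quasinilpotents R"

locale UJ_ring = ring +
  assumes Units_eq_jacobson: "Units R = \<one> <+ jacobson_radical R"

locale UU_ring = ring +
  assumes Units_eq_nilpotents: "Units R = \<one> <+ nilpotents R"

locale boolean_ring = ring +
  assumes idem: "a \<in> carrier R \<Longrightarrow> a \<otimes> a = a"

locale semipotent_ring = ring +
  assumes nonzero_idem: "\<lbrakk>left_ideal I R \<or> right_ideal I R; \<not> I \<subseteq> jacobson_radical R\<rbrakk>
    \<Longrightarrow> \<exists>e \<in> I. e \<noteq> \<zero> \<and> e \<otimes> e = e"

text \<open>
  The radical is a two-sided ideal, so that \<^term>\<open>R Quot jacobson_radical R\<close> is a ring.
\<close>

lemma left_idealI: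
  fixes R (structure)
  assumes "ring R" "I \<subseteq> carrier R" "\<zero> \<in> I"
    and "\<And>a b. a \<in> I \<Longrightarrow> b \<in> I \<Longrightarrow> a \<oplus> b \<in> I"
    and l: "\<And>a x. a \<in> I \<Longrightarrow> x \<in> carrier R \<Longrightarrow> x \<otimes> a \<in> I"
  shows "left_ideal I R"
proof -
  interpret ring R by fact
  have neg: "\<ominus> a \<in> I" if "a \<in> I" for a
    using l[OF that, of "\<ominus> \<one>"] that assms(2) by (simp add: subset_iff l_minus)
  have "subgroup I (add_monoid R)"
    using assms neg by (auto intro!: add.subgroupI simp: a_inv_def)
  then show ?thesis
    by (auto intro!: left_ideal.intro additive_subgroup.intro left_ideal_axioms.intro l
        ring_axioms)
qed

lemma (in ring) maximal_left_ideal_colon: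
  assumes "maximal_left_ideal M R" and r: "r \<in> carrier R" "r \<notin> M"
  shows "maximal_left_ideal {x \<in> carrier R. x \<otimes> r \<in> M} R" (is "maximal_left_ideal ?C R")
proof -
  interpret M: maximal_left_ideal M R by fact
  have C: "left_ideal ?C R"
    using r by (intro left_idealI ring_axioms) (auto simp: l_distr m_assoc M.l_closed M.a_closed)
  have "\<one> \<notin> ?C" using r by auto
  then have nc: "?C \<noteq> carrier R" by blast
  have "L = ?C \<or> L = carrier R" if "left_ideal L R" "?C \<subseteq> L" for L
  proof (cases "L \<subseteq> ?C")
    case True
    then show ?thesis using that by blast
  next
    case False
    interpret L: left_ideal L R by fact
    obtain y where y: "y \<in> L" "y \<in> carrier R" "y \<otimes> r \<notin> M"
      using False L.a_subset by blast
    let ?K = "{z. \<exists>m \<in> M. \<exists>s \<in> carrier R. z = m \<oplus> s \<otimes> (y \<otimes> r)}"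
    have K: "left_ideal ?K R"
    proof (intro left_idealI ring_axioms)
      show "?K \<subseteq> carrier R" using y r M.a_subset by auto
      show "\<zero> \<in> ?K" using y r
        by (auto intro!: bexI[of _ \<zero>])
    next
      fix a b assume "a \<in> ?K" "b \<in> ?K"
      then obtain m s n t where *: "m \<in> M" "s \<in> carrier R" "a = m \<oplus> s \<otimes> (y \<otimes> r)"
        "n \<in> M" "t \<in> carrier R" "b = n \<oplus> t \<otimes> (y \<otimes> r)" by auto
      then have mn: "m \<in> carrier R" "n \<in> carrier R" using M.a_subset by auto
      have "a \<oplus> b = (m \<oplus> n) \<oplus> (s \<oplus> t) \<otimes> (y \<otimes> r)"
        using * mn y r by (simp add: l_distr a_ac)
      then show "a \<oplus> b \<in> ?K" using * M.a_closed by blast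
    next
      fix a x assume "a \<in> ?K" and x: "x \<in> carrier R"
      then obtain m s where *: "m \<in> M" "s \<in> carrier R" "a = m \<oplus> s \<otimes> (y \<otimes> r)" by auto
      then have m: "m \<in> carrier R" using M.a_subset by auto
      have "x \<otimes> a = x \<otimes> m \<oplus> (x \<otimes> s) \<otimes> (y \<otimes> r)"
        using * m x y r by (simp add: r_distr m_assoc)
      then show "x \<otimes> a \<in> ?K" using * x M.l_closed by blast
    qed
    have "M \<subseteq> ?K"
    proof
      fix m assume "m \<in> M"
      then have "m = m \<oplus> \<zero> \<otimes> (y \<otimes> r)" using M.a_subset y r by (auto simp: subset_iff)
      then show "m \<in> ?K" using \<open>m \<in> M\<close> by blast
    qed
    moreover have "y \<otimes> r \<in> ?K"
      using y r M.zero_closed by (auto intro!: bexI[of _ \<zero> M] bexI[of _ \<one> "carrier R"])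
    ultimately have "?K = carrier R" using M.maximal[OF K] y(3) by blast
    then have "r \<in> ?K" using r by simp
    then obtain m s where *: "m \<in> M" "s \<in> carrier R" "r = m \<oplus> s \<otimes> (y \<otimes> r)" by auto
    then have m: "m \<in> carrier R" using M.a_subset by auto
    have sy: "s \<otimes> y \<in> L" "s \<otimes> y \<in> carrier R" using * y L.l_closed by auto
    have "(\<one> \<ominus> s \<otimes> y) \<otimes> r = r \<ominus> s \<otimes> (y \<otimes> r)"
      using * y r by (simp add: a_minus_def l_distr l_minus m_assoc)
    also have "\<dots> = (m \<oplus> s \<otimes> (y \<otimes> r)) \<ominus> s \<otimes> (y \<otimes> r)" using *(3) by simp
    also have "\<dots> = m" using *(2) m y(2) r(1) by (simp add: a_minus_def a_assoc r_neg)
    finally have "\<one> \<ominus> s \<otimes> y \<in> L" using *(1) that(2) sy by auto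
    then have "(\<one> \<ominus> s \<otimes> y) \<oplus> s \<otimes> y \<in> L" using sy L.a_closed by blast
    also have "(\<one> \<ominus> s \<otimes> y) \<oplus> s \<otimes> y = \<one>" using sy by (simp add: a_minus_def a_assoc l_neg)
    finally have "x \<in> L" if "x \<in> carrier R" for x
      using L.l_closed[of \<one> x] that by simp
    then show ?thesis using L.a_subset by blast
  qed
  with C nc show ?thesis
    by (auto intro!: maximal_left_ideal.intro maximal_left_ideal_axioms.intro)
qed

lemma (in ring) jacobson_radical_ideal: "ideal (jacobson_radical R) R"
proof -
  let ?J = "jacobson_radical R"
  have max: "left_ideal M R" if "maximal_left_ideal M R" for M
    using that by (simp add: maximal_left_ideal_def)
  have M: "\<zero> \<in> M" "\<And>a b. a \<in> M \<Longrightarrow> b \<in> M \<Longrightarrow> a \<oplus> b \<in> M"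
    "\<And>a x. a \<in> M \<Longrightarrow> x \<in> carrier R \<Longrightarrow> x \<otimes> a \<in> M" if "maximal_left_ideal M R" for M
  proof -
    interpret M: left_ideal M R by (rule max[OF that])
    show "\<zero> \<in> M" "\<And>a b. a \<in> M \<Longrightarrow> b \<in> M \<Longrightarrow> a \<oplus> b \<in> M"
      "\<And>a x. a \<in> M \<Longrightarrow> x \<in> carrier R \<Longrightarrow> x \<otimes> a \<in> M"
      by (auto intro: M.l_closed)
  qed
  have J: "left_ideal ?J R"
    by (intro left_idealI ring_axioms) (auto simp: jacobson_radical_def M)
  have r: "a \<otimes> x \<in> ?J" if a: "a \<in> ?J" and x: "x \<in> carrier R" for a x
  proof -
    have ac: "a \<in> carrier R" using a by (simp add: jacobson_radical_def)
    have "a \<otimes> x \<in> M" if M: "maximal_left_ideal M R" for M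
    proof (cases "x \<in> M")
      case True
      then show ?thesis using left_ideal.l_closed[OF max[OF M]] ac by blast
    next
      case False
      then show ?thesis using maximal_left_ideal_colon[OF M x] a
        by (auto simp: jacobson_radical_def)
    qed
    then show ?thesis using ac x by (simp add: jacobson_radical_def)
  qed
  show ?thesis
    using left_ideal.l_closed[OF J] r additive_subgroup.a_subgroup[OF left_ideal.axioms(1)[OF J]]
    by (intro idealI ring_axioms)
qed

lemma (in ring) quotient_jacobson_radical_is_ring: "ring (R Quot jacobson_radical R)"
  by (rule ideal.quotient_is_ring[OF jacobson_radical_ideal])

end

theory Submission
  imports Defs
begin

text \<open>
  Write \<open>S\<close> for \<open>R/J(R)\<close>. Units lift modulo \<open>J(R)\<close>, so \<open>R\<close> is UJ exactly when \<open>U(S) = {1}\<close>, which makes \<open>S\<close>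
  UU, hence UQ. The point is that UQ forces \<open>S\<close> to be Boolean. In a UQ ring, a corner \<open>eSe\<close> with
  \<open>e \<noteq> 0\<close> contains no unit \<open>x\<close> for which \<open>e + x\<close> is again a unit of \<open>eSe\<close>. A nonzero element of
  square zero would, via an idempotent in the right ideal it generates, produce \<open>2 \<times> 2\<close> matrix
  units, and such a corner does contain such an \<open>x\<close>; so \<open>S\<close> is reduced and its idempotents are
  central. If \<open>a - a\<^sup>2 \<noteq> 0\<close>, take an idempotent \<open>e = (a - a\<^sup>2) b \<noteq> 0\<close>: both \<open>ae\<close> and \<open>ae - e\<close> are
  units of \<open>eSe\<close>, a contradiction.
\<close>

section \<open>Ring arithmetic, units and cosets of one\<close>

context ring
begin

lemma minus_eq_zero_iff:
  "a \<in> carrier R \<Longrightarrow> b \<in> carrier R \<Longrightarrow> a \<ominus> b = \<zero> \<longleftrightarrow> a = b"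
  by (metis r_neg a_minus_def minus_equality minus_minus a_inv_closed)

lemma minus_self: "a \<in> carrier R \<Longrightarrow> a \<ominus> a = \<zero>"
  by (simp add: a_minus_def r_neg)

lemma add_minus_cancel:
  "a \<in> carrier R \<Longrightarrow> b \<in> carrier R \<Longrightarrow> a \<oplus> (b \<ominus> a) = b"
  by (subst a_comm) (simp_all add: a_minus_def a_assoc l_neg)

lemma r_distr_minus:
  "a \<in> carrier R \<Longrightarrow> b \<in> carrier R \<Longrightarrow> c \<in> carrier R \<Longrightarrow> a \<otimes> (b \<ominus> c) = a \<otimes> b \<ominus> a \<otimes> c"
  by (simp add: a_minus_def r_distr r_minus)

lemma l_distr_minus:
  "a \<in> carrier R \<Longrightarrow> b \<in> carrier R \<Longrightarrow> c \<in> carrier R \<Longrightarrow> (b \<ominus> c) \<otimes> a = b \<otimes> a \<ominus> c \<otimes> a"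
  by (simp add: a_minus_def l_distr l_minus)

lemma UnitsI:
  "u \<in> carrier R \<Longrightarrow> v \<in> carrier R \<Longrightarrow> u \<otimes> v = \<one> \<Longrightarrow> v \<otimes> u = \<one> \<Longrightarrow> u \<in> Units R"
  by (auto simp: Units_def)

lemma Units_left_right:
  assumes "u \<in> carrier R" "v \<in> carrier R" "w \<in> carrier R" "u \<otimes> v = \<one>" "w \<otimes> u = \<one>"
  shows "u \<in> Units R"
proof -
  have "w = w \<otimes> (u \<otimes> v)" using assms by simp
  also have "\<dots> = (w \<otimes> u) \<otimes> v" using assms(1-3) by (simp add: m_assoc)
  finally have "w = v" using assms by simp
  then show ?thesis using assms by (auto intro: UnitsI)
qed

text \<open>A unit \<open>u v\<close> provides a right inverse of \<open>u\<close>, and a unit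
  \<open>v u\<close> a left inverse. This is the form in which units lift modulo the radical, where
  both products are only known to lie in one plus the radical.\<close>

lemma Units_Units_mult:
  assumes "u \<in> carrier R" "v \<in> carrier R" "u \<otimes> v \<in> Units R" "v \<otimes> u \<in> Units R"
  shows "u \<in> Units R"
proof (rule Units_left_right)
  show "u \<otimes> (v \<otimes> inv (u \<otimes> v)) = \<one>"
    using assms by (simp flip: m_assoc)
  show "(inv (v \<otimes> u) \<otimes> v) \<otimes> u = \<one>"
    using assms by (simp add: m_assoc)
qed (use assms in auto)

text \<open>Since \<open>(1 - e) e = 0\<close>, cancelling the unit \<open>1 - e\<close> leaves
  \<open>e = 0\<close>.\<close>

lemma idempotent_zero_if_complement_unit:
  assumes e: "e \<in> carrier R" "e \<otimes> e = e" and u: "\<one> \<ominus> e \<in> Units R"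
  shows "e = \<zero>"
proof -
  have "(\<one> \<ominus> e) \<otimes> e = \<zero>" using e by (simp add: l_distr_minus minus_eq_zero_iff)
  then have "inv (\<one> \<ominus> e) \<otimes> ((\<one> \<ominus> e) \<otimes> e) = \<zero>" using u by simp
  then show ?thesis using u e by (simp flip: m_assoc)
qed

lemma mem_one_coset_iff:
  assumes "A \<subseteq> carrier R" "u \<in> carrier R"
  shows "u \<in> \<one> <+ A \<longleftrightarrow> u \<ominus> \<one> \<in> A"
proof
  assume "u \<in> \<one> <+ A"
  then obtain a where a: "a \<in> A" "u = \<one> \<oplus> a" by (auto simp: a_l_coset_def l_coset_def)
  then have "u \<ominus> \<one> = a" using assms by (auto simp: a_minus_def a_ac r_neg r_neg2)
  then show "u \<ominus> \<one> \<in> A" using a by simp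
next
  assume "u \<ominus> \<one> \<in> A"
  moreover have "u = \<one> \<oplus> (u \<ominus> \<one>)" using assms by (simp add: add_minus_cancel)
  ultimately show "u \<in> \<one> <+ A" by (auto simp: a_l_coset_def l_coset_def)
qed

text \<open>For the radical, the nilpotents and the quasinilpotents alike, one plus the set consists
  of units in every ring. The conditions UJ, UU and UQ therefore only say something about the
  opposite inclusion.\<close>

lemma Units_eq_one_coset_iff:
  assumes "A \<subseteq> carrier R" "\<And>a. a \<in> A \<Longrightarrow> \<one> \<oplus> a \<in> Units R"
  shows "Units R = \<one> <+ A \<longleftrightarrow> (\<forall>u \<in> Units R. u \<ominus> \<one> \<in> A)"
proof -
  have "\<one> <+ A \<subseteq> Units R" using assms by (auto simp: a_l_coset_def l_coset_def)
  then show ?thesis using mem_one_coset_iff[OF assms(1)] by blast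
qed

section \<open>Maximal left ideals and units near one\<close>

lemma left_ideal_one_mem:
  assumes "left_ideal L R" "\<one> \<in> L"
  shows "L = carrier R"
proof -
  interpret left_ideal L R by fact
  have "x \<in> L" if "x \<in> carrier R" for x
    using l_closed[OF assms(2) that] that by simp
  then show ?thesis using a_subset by blast
qed

text \<open>Zorn's lemma on the left ideals that contain \<open>L\<close> and omit 1: the union of a
  chain of them still omits 1, and a left ideal omits 1 exactly when it is proper.\<close>

lemma ex_maximal_left_ideal:
  assumes L: "left_ideal L R" "\<one> \<notin> L"
  obtains M where "maximal_left_ideal M R" "L \<subseteq> M"
proof -
  let ?A = "{K. left_ideal K R \<and> \<one> \<notin> K \<and> L \<subseteq> K}"
  have "\<exists>M\<in>?A. \<forall>X\<in>?A. M \<subseteq> X \<longrightarrow> X = M"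
  proof (rule subset_Zorn_nonempty)
    show "?A \<noteq> {}" using L by blast
  next
    fix C assume C: "C \<noteq> {}" "subset.chain ?A C"
    then have CA: "C \<subseteq> ?A" by (simp add: subset.chain_def)
    then have li: "left_ideal K R" if "K \<in> C" for K using that by blast
    have sg: "additive_subgroup K R" if "K \<in> C" for K
      using li[OF that] left_ideal.axioms(1) by blast
    have "left_ideal (\<Union>C) R"
    proof (rule left_idealI[OF ring_axioms])
      show "\<Union>C \<subseteq> carrier R" using additive_subgroup.a_subset[OF sg] by blast
      show "\<zero> \<in> \<Union>C" using additive_subgroup.zero_closed[OF sg] C(1) by blast
    next
      fix a b assume "a \<in> \<Union>C" "b \<in> \<Union>C"
      then obtain K K' where K: "K \<in> C" "K' \<in> C" "a \<in> K" "b \<in> K'" by blast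
      then have "K \<subseteq> K' \<or> K' \<subseteq> K" using C(2) by (auto simp: subset_chain_def)
      then obtain K'' where "K'' \<in> C" "a \<in> K''" "b \<in> K''" using K by blast
      then show "a \<oplus> b \<in> \<Union>C" using additive_subgroup.a_closed[OF sg] by blast
    next
      fix a x assume "a \<in> \<Union>C" "x \<in> carrier R"
      then show "x \<otimes> a \<in> \<Union>C" using left_ideal.l_closed[OF li] by blast
    qed
    then show "\<Union>C \<in> ?A" using CA C(1) by auto
  qed
  then obtain M where M: "left_ideal M R" "\<one> \<notin> M" "L \<subseteq> M"
    and max: "\<forall>X \<in> ?A. M \<subseteq> X \<longrightarrow> X = M" by blast
  have "maximal_left_ideal M R"
  proof (intro maximal_left_ideal.intro maximal_left_ideal_axioms.intro)
    show "M \<noteq> carrier R" using M one_closed by blast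
    show "K = M \<or> K = carrier R" if "left_ideal K R" "M \<subseteq> K" for K
    proof (cases "\<one> \<in> K")
      case False
      then show ?thesis using that max M(3) by blast
    qed (use left_ideal_one_mem that in blast)
  qed fact
  then show thesis using that M by blast
qed

lemma jacobson_radical_closed: "jacobson_radical R \<subseteq> carrier R"
  by (auto simp: jacobson_radical_def)

text \<open>Otherwise the left ideal generated by \<open>1 + j\<close> is proper and lies in a
  maximal left ideal \<open>M\<close>. As \<open>j\<close> lies in \<open>M\<close> too, so does 1,
  which is absurd.\<close>

lemma one_plus_jacobson_left_invertible:
  assumes j: "j \<in> jacobson_radical R"
  shows "\<exists>v \<in> carrier R. v \<otimes> (\<one> \<oplus> j) = \<one>"
proof (rule ccontr)
  assume *: "\<not> ?thesis"
  have jc: "j \<in> carrier R" using j jacobson_radical_closed by blast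
  let ?L = "(\<lambda>v. v \<otimes> (\<one> \<oplus> j)) ` carrier R"
  have "left_ideal ?L R"
  proof (rule left_idealI[OF ring_axioms])
    show "?L \<subseteq> carrier R" using jc by auto
    have "\<zero> = \<zero> \<otimes> (\<one> \<oplus> j)" using jc by simp
    then show "\<zero> \<in> ?L" by blast
    show "a \<oplus> b \<in> ?L" if ab: "a \<in> ?L" "b \<in> ?L" for a b
    proof -
      obtain v w where v: "v \<in> carrier R" "w \<in> carrier R"
        "a = v \<otimes> (\<one> \<oplus> j)" "b = w \<otimes> (\<one> \<oplus> j)" using ab by auto
      then have "a \<oplus> b = (v \<oplus> w) \<otimes> (\<one> \<oplus> j)" using jc by (simp add: l_distr)
      then show ?thesis using v by (intro image_eqI[where x = "v \<oplus> w"]) auto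
    qed
    show "x \<otimes> a \<in> ?L" if ax: "a \<in> ?L" "x \<in> carrier R" for a x
    proof -
      obtain v where v: "v \<in> carrier R" "a = v \<otimes> (\<one> \<oplus> j)" using ax by auto
      then have "x \<otimes> a = (x \<otimes> v) \<otimes> (\<one> \<oplus> j)" using jc that by (simp add: m_assoc)
      then show ?thesis using v that by (intro image_eqI[where x = "x \<otimes> v"]) auto
    qed
  qed
  moreover have "\<one> \<notin> ?L" using * by auto
  ultimately obtain M where M: "maximal_left_ideal M R" "?L \<subseteq> M"
    by (rule ex_maximal_left_ideal)
  interpret M: maximal_left_ideal M R by fact
  have "\<one> \<otimes> (\<one> \<oplus> j) \<in> ?L" by simp
  then have "\<one> \<otimes> (\<one> \<oplus> j) \<in> M" using M(2) by (rule rev_subsetD)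
  then have 1: "\<one> \<oplus> j \<in> M" using jc by simp
  have 2: "\<ominus> j \<in> M" using j M by (auto simp: jacobson_radical_def)
  have "(\<one> \<oplus> j) \<oplus> \<ominus> j \<in> M" using 1 2 by (rule M.a_closed)
  then have "\<one> \<in> M" using jc by (simp add: a_assoc r_neg)
  then show False
    using left_ideal_one_mem[OF M.left_ideal_axioms] M.not_carrier by blast
qed

text \<open>A left inverse \<open>v\<close> of \<open>1 + j\<close> equals \<open>1 - v j\<close>,
  again one plus a radical element, so \<open>v\<close> has a left inverse as well. With
  \<open>1 + j\<close> as its right inverse, \<open>v\<close> is a unit, and \<open>1 + j\<close> is
  the inverse of \<open>v\<close>.\<close>

lemma one_plus_jacobson_unit:
  assumes j: "j \<in> jacobson_radical R"
  shows "\<one> \<oplus> j \<in> Units R"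
proof -
  interpret J: ideal "jacobson_radical R" R by (rule jacobson_radical_ideal)
  have jc: "j \<in> carrier R" using j jacobson_radical_closed by blast
  obtain v where v: "v \<in> carrier R" "v \<otimes> (\<one> \<oplus> j) = \<one>"
    using one_plus_jacobson_left_invertible[OF j] by blast
  have "v \<oplus> v \<otimes> j = \<one>" using v jc by (simp add: r_distr)
  then have "\<one> \<oplus> \<ominus> (v \<otimes> j) = v" using v jc
    by (metis add.inv_solve_right' m_closed one_closed)
  moreover have "\<ominus> (v \<otimes> j) \<in> jacobson_radical R" using J.I_l_closed j v by simp
  ultimately obtain w where w: "w \<in> carrier R" "w \<otimes> v = \<one>"
    using one_plus_jacobson_left_invertible by metis
  have "v \<in> Units R" using Units_left_right[of v "\<one> \<oplus> j" w] v w jc by simp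
  moreover have "\<one> \<oplus> j = inv v"
    using v jc calculation
    by (metis l_one m_assoc Units_l_inv Units_inv_closed a_closed one_closed r_one)
  ultimately show ?thesis by simp
qed

section \<open>Quasinilpotent and nilpotent elements\<close>

lemma quasinilpotents_closed: "quasinilpotents R \<subseteq> carrier R"
  by (auto simp: quasinilpotents_def)

lemma one_plus_quasinilpotent_unit:
  assumes "a \<in> quasinilpotents R"
  shows "\<one> \<oplus> a \<in> Units R"
proof -
  have a: "a \<in> carrier R" using assms quasinilpotents_closed by blast
  \<comment> \<open>The multiplier -1 commutes with everything and turns \<open>1 - a x\<close> into
    \<open>1 + a\<close>.\<close>
  then have "a \<otimes> \<ominus> \<one> = \<ominus> \<one> \<otimes> a" by (simp add: l_minus r_minus)
  then have "\<one> \<ominus> a \<otimes> \<ominus> \<one> \<in> Units R"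
    using assms by (simp add: quasinilpotents_def)
  with a show ?thesis by (simp add: a_minus_def r_minus)
qed

lemma jacobson_subset_quasinilpotents: "jacobson_radical R \<subseteq> quasinilpotents R"
proof
  interpret J: ideal "jacobson_radical R" R by (rule jacobson_radical_ideal)
  fix a assume a: "a \<in> jacobson_radical R"
  have "\<one> \<ominus> a \<otimes> x \<in> Units R" if "x \<in> carrier R" for x
    using one_plus_jacobson_unit[of "\<ominus> (a \<otimes> x)"] J.I_r_closed[OF a that] by (simp add: a_minus_def)
  then show "a \<in> quasinilpotents R"
    using a jacobson_radical_closed unfolding quasinilpotents_def by blast
qed

lemma one_minus_nilpotent_unit:
  assumes a: "a \<in> carrier R" and n: "a [^] (n::nat) = \<zero>"
  shows "\<one> \<ominus> a \<in> Units R"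
proof -
  \<comment> \<open>The witness built by the induction is the geometric sum of the powers of
    \<open>a\<close> below \<open>n\<close>.\<close>
  have "\<exists>s \<in> carrier R. (\<one> \<ominus> a) \<otimes> s = \<one> \<ominus> a [^] n \<and> s \<otimes> (\<one> \<ominus> a) = \<one> \<ominus> a [^] n" for n :: nat
  proof (induction n)
    case 0
    then show ?case using a by (auto intro!: bexI[of _ \<zero>] simp: a_minus_def r_neg)
  next
    case (Suc n)
    then obtain s where s: "s \<in> carrier R" "(\<one> \<ominus> a) \<otimes> s = \<one> \<ominus> a [^] n"
      "s \<otimes> (\<one> \<ominus> a) = \<one> \<ominus> a [^] n" by blast
    have c: "a [^] n \<in> carrier R" using a by simp
    have tele: "(\<one> \<ominus> b) \<oplus> (b \<ominus> c) = \<one> \<ominus> c" if "b \<in> carrier R" "c \<in> carrier R" for b c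
      using that by (simp add: a_minus_def a_assoc r_neg2 r_neg1)
    have "(\<one> \<ominus> a) \<otimes> (s \<oplus> a [^] n) = \<one> \<ominus> a [^] Suc n"
      using a s c tele[of "a [^] n" "a [^] Suc n"]
      by (simp add: r_distr l_distr_minus flip: nat_pow_Suc2)
    moreover have "(s \<oplus> a [^] n) \<otimes> (\<one> \<ominus> a) = \<one> \<ominus> a [^] Suc n"
      using a s c tele[of "a [^] n" "a [^] Suc n"] by (simp add: l_distr r_distr_minus[of "a [^] n"])
    ultimately show ?case using s c by blast
  qed
  then obtain s where "s \<in> carrier R" "(\<one> \<ominus> a) \<otimes> s = \<one> \<ominus> a [^] n" "s \<otimes> (\<one> \<ominus> a) = \<one> \<ominus> a [^] n"
    by blast
  then show ?thesis using a n by (auto intro!: UnitsI[of _ s] simp: a_minus_def)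
qed

lemma nilpotents_closed: "nilpotents R \<subseteq> carrier R"
  by (auto simp: nilpotents_def)

lemma nilpotents_subset_quasinilpotents: "nilpotents R \<subseteq> quasinilpotents R"
proof
  fix a assume "a \<in> nilpotents R"
  then obtain n :: nat where a: "a \<in> carrier R" "a [^] n = \<zero>" by (auto simp: nilpotents_def)
  have "\<one> \<ominus> a \<otimes> x \<in> Units R" if x: "x \<in> carrier R" "a \<otimes> x = x \<otimes> a" for x
  proof (rule one_minus_nilpotent_unit)
    show "(a \<otimes> x) [^] n = \<zero>" using a x by (simp add: pow_mult_distrib)
  qed (use a x in simp)
  then show "a \<in> quasinilpotents R" using a by (simp add: quasinilpotents_def)
qed

section \<open>UQ, UJ and UU as conditions on units\<close>

lemma UQ_ring_iff: "UQ_ring R \<longleftrightarrow> (\<forall>u \<in> Units R. u \<ominus> \<one> \<in> quasinilpotents R)"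
  using Units_eq_one_coset_iff[OF quasinilpotents_closed one_plus_quasinilpotent_unit] ring_axioms
  by (auto simp: UQ_ring_def UQ_ring_axioms_def)

lemma UJ_ring_iff: "UJ_ring R \<longleftrightarrow> (\<forall>u \<in> Units R. u \<ominus> \<one> \<in> jacobson_radical R)"
  using Units_eq_one_coset_iff[OF jacobson_radical_closed one_plus_jacobson_unit] ring_axioms
  by (auto simp: UJ_ring_def UJ_ring_axioms_def)

lemma UU_ring_iff: "UU_ring R \<longleftrightarrow> (\<forall>u \<in> Units R. u \<ominus> \<one> \<in> nilpotents R)"
  using Units_eq_one_coset_iff[OF nilpotents_closed] one_plus_quasinilpotent_unit
    nilpotents_subset_quasinilpotents ring_axioms
  by (auto simp: UU_ring_def UU_ring_axioms_def)

lemma UU_imp_UQ: "UU_ring R \<Longrightarrow> UQ_ring R"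
  using nilpotents_subset_quasinilpotents by (auto simp: UU_ring_iff UQ_ring_iff)

lemma trivial_units_imp_UU:
  assumes "Units R = {\<one>}"
  shows "UU_ring R"
proof -
  have "\<zero> \<in> nilpotents R" by (auto simp: nilpotents_def intro!: exI[of _ "1::nat"])
  then show ?thesis using assms by (simp add: UU_ring_iff a_minus_def r_neg)
qed

lemma boolean_imp_trivial_units:
  assumes "boolean_ring R"
  shows "Units R = {\<one>}"
proof -
  interpret boolean_ring R by fact
  have "u = \<one>" if "u \<in> Units R" for u
    using that idem[of u] by (metis Units_closed Units_l_cancel r_one one_closed)
  then show ?thesis by auto
qed

text \<open>If \<open>a\<close> is quasinilpotent then \<open>1 + a\<close> is a unit, so UJ forces
  \<open>a\<close> into the radical. The radical always consists of quasinilpotents, hence the two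
  sets coincide.\<close>

lemma UJ_ring_iff_UQ:
  "UJ_ring R \<longleftrightarrow> UQ_ring R \<and> quasinilpotents R = jacobson_radical R"
proof (intro iffI conjI)
  assume UJ: "UJ_ring R"
  have "a \<in> jacobson_radical R" if "a \<in> quasinilpotents R" for a
  proof -
    have "a \<in> carrier R" using that quasinilpotents_closed by blast
    then have "(\<one> \<oplus> a) \<ominus> \<one> = a" by (simp add: a_minus_def a_ac r_neg r_neg2)
    then show ?thesis using UJ one_plus_quasinilpotent_unit[OF that] UJ_ring_iff by metis
  qed
  then show "quasinilpotents R = jacobson_radical R"
    using jacobson_subset_quasinilpotents by blast
  then show "UQ_ring R" using UJ by (simp add: UJ_ring_iff UQ_ring_iff)
qed (auto simp: UJ_ring_iff UQ_ring_iff)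

end

section \<open>Corners of UQ rings\<close>

context UQ_ring
begin

text \<open>In the corner at \<open>e\<close>, \<open>y\<close> is the inverse of \<open>x\<close>
  and \<open>z\<close> that of \<open>e + x\<close>. Then \<open>1 + x = (1 - e) + (e + x)\<close>
  is a unit of the whole ring with inverse \<open>(1 - e) + z\<close>, so UQ makes \<open>x\<close>
  quasinilpotent. Testing this against \<open>y\<close>, which commutes with \<open>x\<close>, shows
  that \<open>1 - e\<close> is a unit.\<close>

lemma corner_unit_exceptional:
  assumes c: "x \<in> carrier R" "y \<in> carrier R" "z \<in> carrier R" "e \<in> carrier R"
    and xy: "x \<otimes> y = e" "y \<otimes> x = e" "e \<otimes> x = x" "x \<otimes> e = x"
    and z: "(e \<oplus> x) \<otimes> z = e" "z \<otimes> (e \<oplus> x) = e" "e \<otimes> z = z" "z \<otimes> e = z"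
  shows "e = \<zero>"
proof -
  have ee: "e \<otimes> e = e" using c xy by (metis m_assoc)
  have x0: "x \<otimes> (\<one> \<ominus> e) = \<zero>" "(\<one> \<ominus> e) \<otimes> x = \<zero>"
    using c xy by (simp_all add: r_distr_minus l_distr_minus minus_eq_zero_iff)
  have "(\<one> \<oplus> x) \<otimes> (\<one> \<ominus> e \<oplus> z) = (\<one> \<ominus> e) \<oplus> (e \<oplus> x) \<otimes> z"
    using c z x0 by (simp add: l_distr r_distr a_assoc)
  also have "\<dots> = \<one>" using c z by (simp add: a_minus_def a_assoc l_neg)
  finally have 1: "(\<one> \<oplus> x) \<otimes> (\<one> \<ominus> e \<oplus> z) = \<one>" .
  have "(\<one> \<ominus> e \<oplus> z) \<otimes> (\<one> \<oplus> x) = (\<one> \<ominus> e) \<oplus> z \<otimes> (e \<oplus> x)"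
    using c z x0 by (simp add: l_distr r_distr a_assoc)
  also have "\<dots> = \<one>" using c z by (simp add: a_minus_def a_assoc l_neg)
  finally have "\<one> \<oplus> x \<in> Units R" using 1 c by (intro UnitsI[of _ "\<one> \<ominus> e \<oplus> z"]) auto
  then have "(\<one> \<oplus> x) \<ominus> \<one> \<in> quasinilpotents R" using UQ_ring_axioms UQ_ring_iff by blast
  then have "x \<in> quasinilpotents R" using c by (simp add: a_minus_def a_ac r_neg r_neg2)
  then have "\<one> \<ominus> e \<in> Units R" using c xy by (auto simp: quasinilpotents_def)
  then show ?thesis using idempotent_zero_if_complement_unit c ee by blast
qed

text \<open>
  Here \<open>p\<close> and \<open>q\<close> act as the matrix units \<open>e\<^sub>1\<^sub>2\<close> and \<open>e\<^sub>2\<^sub>1\<close>; the exceptional unit is the matrix with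
  rows \<open>(0, 1)\<close> and \<open>(1, -1)\<close>, whose inverse is its sum with the identity.
\<close>

lemma square_zero_matrix_unit:
  assumes c: "p \<in> carrier R" "q \<in> carrier R"
    and 0: "p \<otimes> p = \<zero>" "q \<otimes> q = \<zero>" and pqp: "p \<otimes> (q \<otimes> p) = p" and qpq: "q \<otimes> (p \<otimes> q) = q"
  shows "p = \<zero>"
proof -
  let ?e = "p \<otimes> q \<oplus> q \<otimes> p" and ?x = "p \<oplus> q \<ominus> q \<otimes> p" and ?y = "p \<otimes> q \<oplus> p \<oplus> q"
  \<comment> \<open>These are the relations between \<open>p\<close> and \<open>q\<close> with an
    arbitrary tail \<open>t\<close>. Once products are nested to the right, they let the simplifier
    reduce every word in \<open>p\<close> and \<open>q\<close>.\<close>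
  have left: "p \<otimes> (p \<otimes> t) = \<zero>" "q \<otimes> (q \<otimes> t) = \<zero>" "p \<otimes> (q \<otimes> (p \<otimes> t)) = p \<otimes> t"
    "q \<otimes> (p \<otimes> (q \<otimes> t)) = q \<otimes> t" if "t \<in> carrier R" for t
  proof -
    show "p \<otimes> (p \<otimes> t) = \<zero>" "q \<otimes> (q \<otimes> t) = \<zero>" using that c 0 by (simp_all flip: m_assoc)
    show "p \<otimes> (q \<otimes> (p \<otimes> t)) = p \<otimes> t" using that c pqp by (metis m_assoc m_closed)
    show "q \<otimes> (p \<otimes> (q \<otimes> t)) = q \<otimes> t" using that c qpq by (metis m_assoc m_closed)
  qed
  note calc = a_minus_def l_distr r_distr l_minus r_minus minus_add m_assoc left 0 pqp qpq
  have y: "?e \<oplus> ?x = ?y"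
    using c by (simp add: a_minus_def a_ac r_neg r_neg1 r_neg2)
  have "?x \<otimes> ?y = ?e" "?y \<otimes> ?x = ?e" "?e \<otimes> ?x = ?x" "?x \<otimes> ?e = ?x"
    using c by (simp_all add: calc a_ac r_neg r_neg1 r_neg2)
  \<comment> \<open>Since \<open>e + x\<close> is \<open>y\<close>, whose inverse is
    \<open>x\<close>, the element \<open>x\<close> also takes the place of \<open>z\<close>.\<close>
  then have "?e = \<zero>"
    using c y by (intro corner_unit_exceptional[of ?x ?y ?x ?e]) auto
  moreover have "?e \<otimes> p = p" using c by (simp add: calc)
  ultimately show ?thesis using c by (metis l_null)
qed

end

section \<open>UQ rings with many idempotents are Boolean\<close>

text \<open>What being semipotent means for right ideals when the radical is zero.\<close>

locale semipotent_UQ_ring = UQ_ring +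
  assumes nonzero_idem: "\<lbrakk>a \<in> carrier R; a \<noteq> \<zero>\<rbrakk> \<Longrightarrow>
    \<exists>b \<in> carrier R. a \<otimes> b \<noteq> \<zero> \<and> (a \<otimes> b) \<otimes> (a \<otimes> b) = a \<otimes> b"
begin

text \<open>With the idempotent \<open>e = a b\<close>, the elements \<open>p\<close> and
  \<open>q\<close> satisfy the matrix unit relations and \<open>p q = e\<close>. They must therefore
  vanish, contradicting \<open>e \<noteq> 0\<close>.\<close>

lemma reduced:
  assumes a: "a \<in> carrier R" "a \<otimes> a = \<zero>"
  shows "a = \<zero>"
proof (rule ccontr)
  assume "a \<noteq> \<zero>"
  then obtain b where b: "b \<in> carrier R" "a \<otimes> b \<noteq> \<zero>" "(a \<otimes> b) \<otimes> (a \<otimes> b) = a \<otimes> b"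
    using nonzero_idem a by blast
  define e where "e = a \<otimes> b"
  define p where "p = e \<otimes> a"
  \<comment> \<open>Subtracting \<open>e b e\<close> gives \<open>e q = 0\<close>, hence
    \<open>q q = q e q = 0\<close>. The product \<open>a q\<close> is unaffected, because
    \<open>a a = 0\<close> implies \<open>a e = 0\<close>.\<close>
  define q where "q = b \<otimes> e \<ominus> e \<otimes> (b \<otimes> e)"
  have e: "e \<in> carrier R" "e \<otimes> e = e" using a b by (auto simp: e_def)
  have c: "p \<in> carrier R" "q \<in> carrier R" using a b e by (auto simp: p_def q_def)
  have ae: "a \<otimes> e = \<zero>" using a b by (simp add: e_def flip: m_assoc)
  have abe: "a \<otimes> (b \<otimes> e) = e" using a b e by (simp flip: m_assoc add: e_def[symmetric])
  have aq: "a \<otimes> q = e"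
  proof -
    have "a \<otimes> (e \<otimes> (b \<otimes> e)) = (a \<otimes> e) \<otimes> (b \<otimes> e)" using a b e by (simp add: m_assoc)
    then show ?thesis using a b e ae abe by (simp add: q_def r_distr_minus) (simp add: a_minus_def)
  qed
  have qe: "q \<otimes> e = q" using a b e by (simp add: q_def l_distr_minus m_assoc)
  have eq: "e \<otimes> q = \<zero>"
  proof -
    have "e \<otimes> (e \<otimes> (b \<otimes> e)) = e \<otimes> (b \<otimes> e)" using b e by (simp flip: m_assoc)
    then show ?thesis using b e by (simp add: q_def r_distr_minus minus_eq_zero_iff)
  qed
  have pq: "p \<otimes> q = e" using a e c aq by (simp add: p_def m_assoc)
  have "p \<otimes> p = e \<otimes> ((a \<otimes> e) \<otimes> a)" using a e by (simp add: p_def m_assoc)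
  then have "p \<otimes> p = \<zero>" using ae a e by simp
  moreover have "q \<otimes> q = (q \<otimes> e) \<otimes> q" using qe by simp
  then have "q \<otimes> q = \<zero>" using c e eq by (simp add: m_assoc)
  moreover have "p \<otimes> (q \<otimes> p) = e \<otimes> p" using pq c by (simp flip: m_assoc)
  then have "p \<otimes> (q \<otimes> p) = p" using a e by (simp add: p_def flip: m_assoc)
  moreover have "q \<otimes> (p \<otimes> q) = q" using pq qe by simp
  ultimately have "p = \<zero>" using square_zero_matrix_unit c by blast
  then have "e = \<zero>" using pq c by simp
  then show False using b by (simp add: e_def)
qed

text \<open>Both \<open>e x (1 - e)\<close> and \<open>(1 - e) x e\<close> have square zero, so they
  vanish and \<open>e x = e x e = x e\<close>.\<close>

lemma idempotent_central:
  assumes e: "e \<in> carrier R" "e \<otimes> e = e" and x: "x \<in> carrier R"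
  shows "e \<otimes> x = x \<otimes> e"
proof -
  have ee: "e \<otimes> (e \<otimes> t) = e \<otimes> t" if "t \<in> carrier R" for t
    using that e by (simp flip: m_assoc)
  have "e \<otimes> x \<ominus> e \<otimes> (x \<otimes> e) = \<zero>"
    by (rule reduced)
      (use e x in \<open>simp_all add: l_distr_minus r_distr_minus m_assoc ee minus_self\<close>)
  moreover have "x \<otimes> e \<ominus> e \<otimes> (x \<otimes> e) = \<zero>"
    by (rule reduced)
      (use e x in \<open>simp_all add: l_distr_minus r_distr_minus m_assoc ee minus_self\<close>)
  ultimately show ?thesis using e x by (simp add: minus_eq_zero_iff)
qed

text \<open>Central idempotents make one-sided inverses two-sided. From \<open>c d = e\<close>, the
  element \<open>d c\<close> is idempotent and hence central, so
  \<open>(d c) c = c (d c) = c\<close>. Multiplying by \<open>d\<close> on the right yields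
  \<open>d c = e\<close>.\<close>

lemma corner_right_inverse:
  assumes c: "c \<in> carrier R" "d \<in> carrier R" "e \<in> carrier R"
    and cd: "c \<otimes> d = e" and ee: "e \<otimes> e = e" and ce: "c \<otimes> e = c" and de: "d \<otimes> e = d"
  shows "d \<otimes> c = e"
proof -
  have ec: "e \<otimes> c = c" using idempotent_central[of e c] c ee ce by simp
  have "(d \<otimes> c) \<otimes> (d \<otimes> c) = d \<otimes> ((c \<otimes> d) \<otimes> c)" using c by (simp add: m_assoc)
  then have "(d \<otimes> c) \<otimes> (d \<otimes> c) = d \<otimes> c" using cd ec by simp
  then have "(d \<otimes> c) \<otimes> c = c \<otimes> (d \<otimes> c)" using idempotent_central[of "d \<otimes> c" c] c by simp
  also have "\<dots> = c" using c cd ec by (simp flip: m_assoc)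
  finally have "(d \<otimes> c) \<otimes> (c \<otimes> d) = c \<otimes> d" using c by (simp flip: m_assoc)
  then have "d \<otimes> (c \<otimes> e) = e" using c cd by (simp add: m_assoc)
  then show ?thesis using ce by simp
qed

lemma boolean: "boolean_ring R"
proof (unfold_locales, rule ccontr)
  fix a assume a: "a \<in> carrier R" and n: "a \<otimes> a \<noteq> a"
  let ?m = "a \<ominus> a \<otimes> a"
  have "?m \<noteq> \<zero>" using a n minus_eq_zero_iff[of a "a \<otimes> a"] by auto
  then obtain b where b: "b \<in> carrier R" "?m \<otimes> b \<noteq> \<zero>" "(?m \<otimes> b) \<otimes> (?m \<otimes> b) = ?m \<otimes> b"
    using nonzero_idem a by (metis minus_closed m_closed)
  define e where "e = ?m \<otimes> b"
  have e: "e \<in> carrier R" "e \<otimes> e = e" using a b by (auto simp: e_def)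
  note cen = idempotent_central[OF e]
  let ?f = "\<one> \<ominus> a"
  have f: "?f \<in> carrier R" using a by simp
  have m: "a \<otimes> ?f = ?m" "?f \<otimes> a = ?m" using a by (simp_all add: r_distr_minus l_distr_minus)
  \<comment> \<open>Whenever \<open>g h = a - a a\<close>, centrality of \<open>e\<close> gives
    \<open>(g e) (h b e) = (g h b) e = e\<close>. It is used for both orders of the factors
    \<open>a\<close> and \<open>1 - a\<close>.\<close>
  have corner: "(g \<otimes> e) \<otimes> (h \<otimes> b \<otimes> e) = e" "(h \<otimes> b \<otimes> e) \<otimes> (g \<otimes> e) = e"
    if g: "g \<in> carrier R" "h \<in> carrier R" "g \<otimes> h = ?m" for g h
  proof -
    have "(g \<otimes> e) \<otimes> (h \<otimes> b \<otimes> e) = g \<otimes> (e \<otimes> (h \<otimes> b)) \<otimes> e"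
      using g(1,2) b(1) e by (simp add: m_assoc)
    also have "\<dots> = ((g \<otimes> h) \<otimes> b) \<otimes> (e \<otimes> e)"
      using g(1,2) b(1) e cen[of "h \<otimes> b"] by (simp add: m_assoc)
    also have "\<dots> = e" using e by (simp add: g(3) flip: e_def)
    finally show 1: "(g \<otimes> e) \<otimes> (h \<otimes> b \<otimes> e) = e" .
    show "(h \<otimes> b \<otimes> e) \<otimes> (g \<otimes> e) = e"
      using g(1,2) b(1) e by (intro corner_right_inverse[OF _ _ e(1) 1 e(2)]) (simp_all add: m_assoc)
  qed
  note A = corner[OF a f m(1)] and F = corner[OF f a m(2)]
  \<comment> \<open>The exceptional unit is \<open>x = -(1 - a) e\<close>, with inverse
    \<open>-(a b e)\<close>. Its sum with \<open>e\<close> is \<open>a e\<close>, with inverse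
    \<open>(1 - a) b e\<close>.\<close>
  have x: "e \<oplus> \<ominus> (?f \<otimes> e) = a \<otimes> e"
    using a e by (simp add: a_minus_def l_distr l_minus minus_add r_neg2)
  have "e = \<zero>"
  proof (rule corner_unit_exceptional[of "\<ominus> (?f \<otimes> e)" "\<ominus> (a \<otimes> b \<otimes> e)" "?f \<otimes> b \<otimes> e"], unfold x)
    show "\<ominus> (?f \<otimes> e) \<otimes> \<ominus> (a \<otimes> b \<otimes> e) = e" "\<ominus> (a \<otimes> b \<otimes> e) \<otimes> \<ominus> (?f \<otimes> e) = e"
      using F a b(1) e f by (simp_all add: l_minus r_minus)
    show 1: "\<ominus> (?f \<otimes> e) \<otimes> e = \<ominus> (?f \<otimes> e)" "?f \<otimes> b \<otimes> e \<otimes> e = ?f \<otimes> b \<otimes> e"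
      using e b(1) f by (simp_all add: l_minus m_assoc)
    show "e \<otimes> \<ominus> (?f \<otimes> e) = \<ominus> (?f \<otimes> e)" "e \<otimes> (?f \<otimes> b \<otimes> e) = ?f \<otimes> b \<otimes> e"
      using trans[OF cen 1(1)] trans[OF cen 1(2)] e b(1) f by simp_all
  qed (use A a b(1) e f in auto)
  then show False using b by (simp add: e_def)
qed

end

section \<open>Passing to the quotient by the radical\<close>

context ring
begin

lemma carrier_quotient: "carrier (R Quot I) = (+>) I ` carrier R"
  unfolding FactRing_def A_RCOSETS_def' by auto

lemma quotient_jacobson_zero_iff:
  assumes "a \<in> carrier R"
  shows "jacobson_radical R +> a = \<zero>\<^bsub>R Quot jacobson_radical R\<^esub> \<longleftrightarrow> a \<in> jacobson_radical R"
proof -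
  interpret J: ideal "jacobson_radical R" R by (rule jacobson_radical_ideal)
  show ?thesis
    using J.rcos_const_imp_mem[OF assms] J.a_rcos_const by (auto simp: FactRing_def)
qed

text \<open>The quotient map preserves and reflects units, and it sends \<open>a\<close> to 1
  exactly when \<open>a - 1\<close> lies in the radical.\<close>

lemma UJ_ring_iff_quotient_trivial_units:
  "UJ_ring R \<longleftrightarrow> Units (R Quot jacobson_radical R) = {\<one>\<^bsub>R Quot jacobson_radical R\<^esub>}"
proof -
  let ?J = "jacobson_radical R"
  let ?S = "R Quot ?J"
  interpret J: ideal ?J R by (rule jacobson_radical_ideal)
  interpret S: ring ?S by (rule quotient_jacobson_radical_is_ring)
  interpret h: ring_hom_ring R ?S "(+>) ?J" by (rule J.rcos_ring_hom_ring)
  have surj: "\<exists>a \<in> carrier R. s = ?J +> a" if "s \<in> carrier ?S" for s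
    using that by (auto simp: carrier_quotient)
  have eq_one: "?J +> a = \<one>\<^bsub>?S\<^esub> \<longleftrightarrow> a \<ominus> \<one> \<in> ?J" if "a \<in> carrier R" for a
  proof -
    have "?J +> (a \<ominus> \<one>) = (?J +> a) \<ominus>\<^bsub>?S\<^esub> \<one>\<^bsub>?S\<^esub>" using that by (simp add: a_minus_def S.minus_eq)
    then show ?thesis
      using that quotient_jacobson_zero_iff[of "a \<ominus> \<one>"] S.minus_eq_zero_iff by simp
  qed
  have lift: "a \<in> Units R" if a: "a \<in> carrier R" "?J +> a \<in> Units ?S" for a
  proof -
    obtain t where t: "t \<in> carrier ?S" "(?J +> a) \<otimes>\<^bsub>?S\<^esub> t = \<one>\<^bsub>?S\<^esub>" "t \<otimes>\<^bsub>?S\<^esub> (?J +> a) = \<one>\<^bsub>?S\<^esub>"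
      using a(2) by (auto simp: Units_def)
    obtain b where b: "b \<in> carrier R" "t = ?J +> b" using surj t by blast
    \<comment> \<open>Lifting an inverse from the quotient puts \<open>a b\<close> and
      \<open>b a\<close> into one plus the radical, so both are units.\<close>
    have "a \<otimes> b \<ominus> \<one> \<in> ?J" "b \<otimes> a \<ominus> \<one> \<in> ?J" using eq_one[of "a \<otimes> b"] eq_one[of "b \<otimes> a"] a b t by simp_all
    then have "a \<otimes> b \<in> Units R" "b \<otimes> a \<in> Units R"
      using one_plus_jacobson_unit a b by (metis add_minus_cancel m_closed one_closed)+
    then show ?thesis using Units_Units_mult a b by blast
  qed
  have push: "?J +> a \<in> Units ?S" if "a \<in> Units R" for a
  proof (rule S.UnitsI)
    show "(?J +> a) \<otimes>\<^bsub>?S\<^esub> (?J +> inv a) = \<one>\<^bsub>?S\<^esub>" "(?J +> inv a) \<otimes>\<^bsub>?S\<^esub> (?J +> a) = \<one>\<^bsub>?S\<^esub>"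
      using that Units_closed[OF that] by (simp_all flip: h.hom_mult)
  qed (use that in auto)
  show ?thesis
  proof
    assume UJ: "UJ_ring R"
    have "s = \<one>\<^bsub>?S\<^esub>" if s: "s \<in> Units ?S" for s
    proof -
      obtain a where a: "a \<in> carrier R" "s = ?J +> a" using surj s S.Units_closed by blast
      then have "a \<ominus> \<one> \<in> ?J" using UJ lift s UJ_ring_iff by blast
      then show ?thesis using a eq_one by simp
    qed
    then show "Units ?S = {\<one>\<^bsub>?S\<^esub>}" using S.Units_one_closed by blast
  next
    assume "Units ?S = {\<one>\<^bsub>?S\<^esub>}"
    then show "UJ_ring R" using push eq_one Units_closed by (auto simp: UJ_ring_iff)
  qed
qed

end

text \<open>Lift \<open>s\<close> to \<open>a\<close> and take a nonzero idempotent
  \<open>a b\<close> in the right ideal \<open>a R\<close>, which is not inside the radical. Its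
  image stays nonzero because the radical contains no idempotent other than 0.\<close>

lemma (in semipotent_ring) quotient_nonzero_idem:
  fixes S
  defines "S \<equiv> R Quot jacobson_radical R"
  assumes s: "s \<in> carrier S" "s \<noteq> \<zero>\<^bsub>S\<^esub>"
  shows "\<exists>t \<in> carrier S. s \<otimes>\<^bsub>S\<^esub> t \<noteq> \<zero>\<^bsub>S\<^esub> \<and> (s \<otimes>\<^bsub>S\<^esub> t) \<otimes>\<^bsub>S\<^esub> (s \<otimes>\<^bsub>S\<^esub> t) = s \<otimes>\<^bsub>S\<^esub> t"
proof -
  let ?J = "jacobson_radical R"
  interpret J: ideal ?J R by (rule jacobson_radical_ideal)
  interpret h: ring_hom_ring R S "(+>) ?J" unfolding S_def by (rule J.rcos_ring_hom_ring)
  obtain a where a: "a \<in> carrier R" "s = ?J +> a"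
    using s by (auto simp: S_def carrier_quotient)
  have aJ: "a \<notin> ?J" using s a quotient_jacobson_zero_iff by (simp add: S_def)
  let ?I = "{a \<otimes> b | b. b \<in> carrier R}"
  have add: "x \<oplus> y \<in> ?I" if "x \<in> ?I" "y \<in> ?I" for x y
    using that a by (force simp flip: r_distr)
  have mult: "x \<otimes> r \<in> ?I" if "x \<in> ?I" "r \<in> carrier R" for x r
    using that a by (force simp: m_assoc)
  have Ic: "?I \<subseteq> carrier R" using a by auto
  have neg: "\<ominus> x \<in> ?I" if "x \<in> ?I" for x
  proof -
    have "x \<otimes> \<ominus> \<one> \<in> ?I" using mult[OF that] by simp
    then show ?thesis using that Ic by (simp add: r_minus subset_iff)
  qed
  have "subgroup ?I (add_monoid R)"
    using add Ic neg a by (intro add.subgroupI) (auto simp: a_inv_def)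
  then have "right_ideal ?I R"
    by (intro right_ideal.intro additive_subgroup.intro right_ideal_axioms.intro mult ring_axioms)
  moreover have "a \<otimes> \<one> \<in> ?I" by blast
  then have "\<not> ?I \<subseteq> ?J" using a aJ by auto
  ultimately obtain b where b: "b \<in> carrier R" "a \<otimes> b \<noteq> \<zero>" "(a \<otimes> b) \<otimes> (a \<otimes> b) = a \<otimes> b"
    using nonzero_idem[of ?I] by auto
  have "a \<otimes> b \<notin> ?J"
  proof
    assume "a \<otimes> b \<in> ?J"
    then have "\<one> \<ominus> a \<otimes> b \<in> Units R"
      using one_plus_jacobson_unit[of "\<ominus> (a \<otimes> b)"] by (simp add: a_minus_def)
    then show False using idempotent_zero_if_complement_unit a b by blast
  qed
  then have "?J +> (a \<otimes> b) \<noteq> \<zero>\<^bsub>S\<^esub>"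
    using quotient_jacobson_zero_iff[of "a \<otimes> b"] a b by (simp add: S_def)
  moreover have "(?J +> (a \<otimes> b)) \<otimes>\<^bsub>S\<^esub> (?J +> (a \<otimes> b)) = ?J +> (a \<otimes> b)"
    using a b by (simp flip: h.hom_mult)
  ultimately show ?thesis using a b by (intro bexI[of _ "?J +> b"]) simp_all
qed

theorem theorem3p13:
  fixes R :: "('a, 'b) ring_scheme"
  assumes "semipotent_ring R"
  shows "(UQ_ring (R Quot jacobson_radical R) \<longleftrightarrow> boolean_ring (R Quot jacobson_radical R)) \<and>
    (boolean_ring (R Quot jacobson_radical R) \<longleftrightarrow> UJ_ring R) \<and>
    (UJ_ring R \<longleftrightarrow> UU_ring (R Quot jacobson_radical R)) \<and>
    (UU_ring (R Quot jacobson_radical R) \<longleftrightarrow>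
      UQ_ring R \<and> quasinilpotents R = jacobson_radical R)"
proof -
  let ?S = "R Quot jacobson_radical R"
  interpret semipotent_ring R by fact
  interpret S: ring ?S by (rule quotient_jacobson_radical_is_ring)
  have "boolean_ring ?S" if "UQ_ring ?S"
    using that quotient_nonzero_idem
    by (intro semipotent_UQ_ring.boolean semipotent_UQ_ring.intro semipotent_UQ_ring_axioms.intro)
  \<comment> \<open>Boolean gives trivial units, then UU, then UQ, which closes a cycle on the
    quotient. Trivial units there mean UJ for \<open>R\<close>, which in turn is the last
    condition.\<close>
  then show ?thesis
    using S.boolean_imp_trivial_units S.trivial_units_imp_UU S.UU_imp_UQ
      UJ_ring_iff_quotient_trivial_units UJ_ring_iff_UQ by blast
qed

end
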